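(* We have $$\tilde{\mathfrak{S}}(213,321)^{\mathsf{des},\mathsf{iar},\mathsf{comp}}(t,r,p)=\frac{1}{1-rpz}+\frac{tz}{(1-z)(1-rz)(1-rpz)}.$$
   Context: $\mathfrak{S}_n$ is the set of permutations $\pi=\pi(1)\cdots\pi(n)$ of $[n]=\{1,\dots,n\}$. A permutation $\pi\in\mathfrak{S}_n$ contains the pattern $\sigma\in\mathfrak{S}_k$ if there are $j_1<\cdots<j_k$ such that $\pi(j_a)<\pi(j_b)$ if and only if $\sigma(a)<\sigma(b)$ for all $1\le a<b\le k$; otherwise it avoids $\sigma$. For a set $P$ of patterns, $\mathfrak{S}_n(P)$ is the set of $\pi\in\mathfrak{S}_n$ avoiding every pattern in $P$. For $\pi\in\mathfrak{S}_n$: $\mathrm{DES}(\pi)=\{i\in[n-1]:\pi(i)>\pi(i+1)\}$, $\mathsf{des}(\pi)=|\mathrm{DES}(\pi)|$, $\mathsf{iar}(\pi)=\min(\mathrm{DES}(\pi)\cup\{n\})$, $\mathsf{comp}(\pi)=|\{i\in[n]:\pi(j)\le i\text{ for all }j\le i\}|$. Define the formal power series in $z$ $$\mathfrak{S}(P)^{\mathsf{des},\mathsf{iar},\mathsf{comp}}(t,r,p;z)=\sum_{n\ge0}z^n\sum_{\pi\in\mathfrak{S}_n(P)}t^{\mathsf{des}(\pi)}r^{\mathsf{iar}(\pi)}p^{\mathsf{comp}(\pi)},$$ where the empty permutation ($n=0$) contributes $1$, and $\tilde{\mathfrak{S}}(P)^{\mathsf{des},\mathsf{iar},\mathsf{comp}}(t,r,p)=\big(\mathfrak{S}(P)^{\mathsf{des},\mathsf{iar},\mathsf{comp}}(t,r,p;z)-1\big)/(rpz)$.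 *)

theory Defs
  imports
    "HOL-Combinatorics.Multiset_Permutations"
    "HOL-Computational_Algebra.Formal_Power_Series"
begin

text \<open>
  A permutation of \<open>{1..n}\<close> is its one-line word, an element of
  \<^term>\<open>permutations_of_set {1..n::nat}\<close>. Positions are counted from \<open>1\<close>:
  \<open>entry w i\<close> is \<open>w(i)\<close>, meaningful only for \<open>1 \<le> i \<le> length w\<close>.
\<close>

definition entry :: "nat list \<Rightarrow> nat \<Rightarrow> nat" where
  "entry w i = w ! (i - 1)"

definition contains_pattern :: "nat list \<Rightarrow> nat list \<Rightarrow> bool" where
  "contains_pattern w \<sigma> \<longleftrightarrow>
     (\<exists>j. strict_mono_on {1..length \<sigma>} j \<and> j ` {1..length \<sigma>} \<subseteq> {1..length w} \<and>
       (\<forall>a b. 1 \<le> a \<and> a < b \<and> b \<le> length \<sigma> \<longrightarrow>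
          (entry w (j a) < entry w (j b) \<longleftrightarrow> entry \<sigma> a < entry \<sigma> b)))"

definition avoiders :: "nat list set \<Rightarrow> nat \<Rightarrow> nat list set" where
  "avoiders P n =
     {w \<in> permutations_of_set {1..n}. \<forall>\<sigma>\<in>P. \<not> contains_pattern w \<sigma>}"

definition DES :: "nat list \<Rightarrow> nat set" where
  "DES w = {i. 1 \<le> i \<and> i < length w \<and> entry w i > entry w (i + 1)}"

definition des :: "nat list \<Rightarrow> nat" where
  "des w = card (DES w)"

definition iar :: "nat list \<Rightarrow> nat" where
  "iar w = Min (DES w \<union> {length w})"

definition comp :: "nat list \<Rightarrow> nat" where
  "comp w = card {i \<in> {1..length w}. \<forall>j\<in>{1..i}. entry w j \<le> i}"

text \<open>The power series variable \<open>z\<close> is \<^term>\<open>fps_X\<close>.\<close>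

definition S_gf ::
  "nat list set \<Rightarrow> 'a \<Rightarrow> 'a \<Rightarrow> 'a \<Rightarrow> 'a::comm_semiring_1 fps" where
  "S_gf P t r p =
     Abs_fps (\<lambda>n. \<Sum>w\<in>avoiders P n. t ^ des w * r ^ iar w * p ^ comp w)"

text \<open>
  The division is exact: a nonempty permutation has \<open>iar\<close> and \<open>comp\<close> at least \<open>1\<close>.
  It is meaningful only for \<open>r, p \<noteq> 0\<close>. The indeterminates \<open>t, r, p\<close> are covered by
  taking the field to be the fraction field of a polynomial ring in them.
\<close>

definition S_tilde ::
  "nat list set \<Rightarrow> 'a \<Rightarrow> 'a \<Rightarrow> 'a \<Rightarrow> 'a::field fps" where
  "S_tilde P t r p = (S_gf P t r p - 1) / (fps_const r * fps_const p * fps_X)"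

end

theory Submission
  imports Defs
begin

text \<open>
  Let \<open>w\<close> avoid both patterns and have a descent \<open>w(d) > w(d+1)\<close>. The pattern \<open>213\<close> keeps all
  later letters below \<open>w(d)\<close>, and \<open>321\<close> then forces the letters after position \<open>d\<close> to increase;
  similarly the letters up to position \<open>d\<close> increase. Finally, by \<open>213\<close>, a letter of the first
  run cannot lie strictly between two letters of the second one, so the first run is \<open>A @ B\<close>
  with \<open>A\<close> below and \<open>B\<close> above the whole second run \<open>C\<close>. Hence \<open>A @ C @ B\<close> is the identity
  and \<open>w = A @ B @ C\<close>: the avoiders are exactly the words obtained from the identity by
  exchanging its last block with an adjacent one (\<open>avoiders_eq\<close>).

  With block lengths \<open>c, b, a\<close>, where \<open>a, b > 0\<close>, such a word has a single descent,
  at position \<open>c + b\<close>, and \<open>c + 1\<close> components: the \<open>c\<close> fixed letters and one indecomposable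
  rest. It therefore has weight \<open>t r\<^sup>c\<^sup>+\<^sup>b p\<^sup>c\<^sup>+\<^sup>1\<close>, and these statistics recover
  \<open>c, b, a\<close>. After division by \<open>rpz\<close>, the free choices of
  \<open>a - 1\<close>, \<open>b - 1\<close> and \<open>c\<close> become the geometric series \<open>1/(1-z)\<close>, \<open>1/(1-rz)\<close> and
  \<open>1/(1-rpz)\<close>; the factor \<open>tz\<close> remains. The identity, of weight \<open>r\<^sup>np\<^sup>n\<close>, gives the
  first summand.
\<close>

section \<open>Patterns of length three\<close>

lemma contains_pattern_3_iff:
  "contains_pattern w [x, y, z] \<longleftrightarrow>
    (\<exists>i j k. i < j \<and> j < k \<and> k < length w \<and>
      (w ! i < w ! j \<longleftrightarrow> x < y) \<and> (w ! i < w ! k \<longleftrightarrow> x < z) \<and> (w ! j < w ! k \<longleftrightarrow> y < z))"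
  (is "?L \<longleftrightarrow> ?R")
proof
  have I: "{1..length [x, y, z]} = {1, 2, 3}" by auto
  assume ?L
  then obtain f where f: "strict_mono_on {1, 2, 3} f" "f ` {1, 2, 3} \<subseteq> {1..length w}"
    and *: "\<And>a b. 1 \<le> a \<Longrightarrow> a < b \<Longrightarrow> b \<le> 3 \<Longrightarrow>
      entry w (f a) < entry w (f b) \<longleftrightarrow> entry [x, y, z] a < entry [x, y, z] b"
    unfolding contains_pattern_def I by auto
  have "f 1 < f 2" "f 2 < f 3" "1 \<le> f 1" "f 3 \<le> length w"
    using f by (auto simp: strict_mono_on_def)
  then show ?R
    using *[of 1 2] *[of 1 3] *[of 2 3]
    by (intro exI[of _ "f 1 - 1"] exI[of _ "f 2 - 1"] exI[of _ "f 3 - 1"])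
      (simp add: entry_def numeral_3_eq_3 numeral_2_eq_2 less_diff_iff)
next
  assume ?R
  then obtain i j k where ijk: "i < j" "j < k" "k < length w"
    and *: "w ! i < w ! j \<longleftrightarrow> x < y" "w ! i < w ! k \<longleftrightarrow> x < z" "w ! j < w ! k \<longleftrightarrow> y < z"
    by blast
  define f where "f a = (if a = 1 then Suc i else if a = 2 then Suc j else Suc k)" for a :: nat
  have I: "{1..length [x, y, z]} = {1, 2, 3}" by auto
  have cases: "a = 1 \<and> b = 2 \<or> a = 1 \<and> b = 3 \<or> a = 2 \<and> b = 3"
    if "1 \<le> a" "a < b" "b \<le> length [x, y, z]" for a b
    using that by auto
  have "entry w (f a) < entry w (f b) \<longleftrightarrow> entry [x, y, z] a < entry [x, y, z] b"
    if "1 \<le> a \<and> a < b \<and> b \<le> length [x, y, z]" for a b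
    using cases[of a b] that * by (auto simp: f_def entry_def)
  moreover have "strict_mono_on {1, 2, 3} f" "f ` {1, 2, 3} \<subseteq> {1..length w}"
    using ijk by (auto simp: f_def strict_mono_on_def)
  ultimately show ?L
    unfolding contains_pattern_def I by blast
qed

lemma contains_213_iff:
  assumes "distinct w"
  shows "contains_pattern w [2, 1, 3] \<longleftrightarrow>
    (\<exists>i j k. i < j \<and> j < k \<and> k < length w \<and> w ! j < w ! i \<and> w ! i < w ! k)"
proof -
  have "w ! i \<noteq> w ! j" if "i < j" "j < k" "k < length w" for i j k
    using assms that by (simp add: nth_eq_iff_index_eq)
  then have "(i < j \<and> j < k \<and> k < length w \<and> (w ! i < w ! j \<longleftrightarrow> (2::nat) < 1) \<and>
      (w ! i < w ! k \<longleftrightarrow> (2::nat) < 3) \<and> (w ! j < w ! k \<longleftrightarrow> (1::nat) < 3)) \<longleftrightarrow>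
      (i < j \<and> j < k \<and> k < length w \<and> w ! j < w ! i \<and> w ! i < w ! k)" for i j k
    by (cases "i < j \<and> j < k \<and> k < length w") (auto simp: not_less less_le)
  then show ?thesis
    unfolding contains_pattern_3_iff by simp
qed

lemma contains_321_iff:
  assumes "distinct w"
  shows "contains_pattern w [3, 2, 1] \<longleftrightarrow>
    (\<exists>i j k. i < j \<and> j < k \<and> k < length w \<and> w ! k < w ! j \<and> w ! j < w ! i)"
proof -
  have "w ! i \<noteq> w ! j \<and> w ! j \<noteq> w ! k" if "i < j" "j < k" "k < length w" for i j k
    using assms that by (simp add: nth_eq_iff_index_eq)
  then have "(i < j \<and> j < k \<and> k < length w \<and> (w ! i < w ! j \<longleftrightarrow> (3::nat) < 2) \<and>
      (w ! i < w ! k \<longleftrightarrow> (3::nat) < 1) \<and> (w ! j < w ! k \<longleftrightarrow> (2::nat) < 1)) \<longleftrightarrow>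
      (i < j \<and> j < k \<and> k < length w \<and> w ! k < w ! j \<and> w ! j < w ! i)" for i j k
    by (cases "i < j \<and> j < k \<and> k < length w") (auto simp: not_less less_le)
  then show ?thesis
    unfolding contains_pattern_3_iff by simp
qed

section \<open>Exchanging two adjacent blocks of the identity\<close>

text \<open>
  The arguments are the lengths of the three blocks in the order in which they occur in the
  word. Empty blocks are admitted: if \<open>b = 0\<close> or \<open>a = 0\<close>, the word is the identity.
\<close>

definition block_swap :: "nat \<Rightarrow> nat \<Rightarrow> nat \<Rightarrow> nat list" where
  "block_swap c b a =
     [1..<Suc c] @ [Suc (c + a)..<Suc (c + a + b)] @ [Suc c..<Suc (c + a)]"

lemma length_block_swap [simp]: "length (block_swap c b a) = c + b + a"
  by (simp add: block_swap_def)

lemma block_swap_0: "block_swap n 0 0 = [1..<Suc n]"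
  by (simp add: block_swap_def)

lemma nth_block_swap:
  assumes "i < c + b + a"
  shows "block_swap c b a ! i = 
    (if i < c then Suc i else if i < c + b then Suc i + a else Suc i - b)"
  using assms by (auto simp: block_swap_def nth_append simp del: upt_Suc)

lemma entry_block_swap:
  assumes "1 \<le> i" "i \<le> c + b + a"
  shows "entry (block_swap c b a) i =
    (if i \<le> c then i else if i \<le> c + b then i + a else i - b)"
  using assms nth_block_swap[of "i - 1" c b a] by (auto simp: entry_def)

lemma block_swap_in_permutations: "block_swap c b a \<in> permutations_of_set {1..c + b + a}"
proof -
  have "set (block_swap c b a) = {1..c + b + a}" 
    by (auto simp: block_swap_def simp del: upt_Suc)
  moreover have "distinct (block_swap c b a)"
    by (auto simp: block_swap_def simp del: upt_Suc)
  ultimately show ?thesis by (simp add: permutations_of_set_def)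
qed

lemma block_swap_in_avoiders: "block_swap c b a \<in> avoiders {[2,1,3], [3,2,1]} (c + b + a)"
proof -
  let ?w = "block_swap c b a"
  have P: "?w \<in> permutations_of_set {1..c + b + a}"
    by (rule block_swap_in_permutations)
  then have d: "distinct ?w" by (simp add: permutations_of_set_def)
  have "\<not> contains_pattern ?w [2, 1, 3]"
    unfolding contains_213_iff[OF d] by (auto simp: nth_block_swap split: if_splits)
  moreover have "\<not> contains_pattern ?w [3, 2, 1]"
    unfolding contains_321_iff[OF d] by (auto simp: nth_block_swap split: if_splits)
  ultimately show ?thesis using P by (simp add: avoiders_def)
qed

lemma append_eq_block_swap:
  assumes "A @ C @ B = [1..<Suc n]"
  shows "A @ B @ C = block_swap (length A) (length B) (length C)"
    and "length A + length B + length C = n"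
proof -
  have "length (A @ C @ B) = n" using assms by simp
  then show n: "length A + length B + length C = n" by simp
  have A: "A = take (length A) [1..<Suc n]" and CB: "C @ B = drop (length A) [1..<Suc n]"
    using assms by (auto simp: append_eq_conv_conj)
  have C: "C = take (length C) (drop (length A) [1..<Suc n])"
    and B: "B = drop (length C) (drop (length A) [1..<Suc n])"
    using CB by (auto simp: append_eq_conv_conj)
  have "A = [1..<Suc (length A)]"
    using A n by (simp del: upt_Suc)
  moreover have "C = [Suc (length A)..<Suc (length A + length C)]"
    using C n by (simp del: upt_Suc)
  moreover have "B = [Suc (length A + length C)..<Suc (length A + length C + length B)]"
    using B n by (simp add: ac_simps del: upt_Suc)
  ultimately show "A @ B @ C = block_swap (length A) (length B) (length C)"
    unfolding block_swap_def by presburger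
qed

section \<open>The avoiders\<close>

lemma strict_sorted_eq_upt:
  assumes "sorted_wrt (<) w" "set w = {1..n::nat}"
  shows "w = [1..<Suc n]"
proof (rule sorted_distinct_set_unique)
  show "set w = set [1..<Suc n]" using assms(2) by (auto simp del: upt_Suc)
qed (use assms(1) in \<open>auto simp: strict_sorted_iff simp del: upt_Suc\<close>)

lemma sorted_partition_less:
  "sorted xs \<Longrightarrow> filter (\<lambda>x. x < m) xs @ filter (\<lambda>x. \<not> x < m) xs = xs"
  for m :: "'b::linorder"
proof (induction xs)
  case (Cons x xs)
  show ?case
  proof (cases "x < m")
    case False
    then have "\<forall>y\<in>set xs. \<not> y < m" using Cons.prems by auto
    then have "filter (\<lambda>x. x < m) xs = []" "filter (\<lambda>x. \<not> x < m) xs = xs"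
      by (simp_all add: filter_empty_conv filter_id_conv)
    with False show ?thesis by simp
  qed (use Cons in simp)
qed simp

text \<open>
  Any descent may serve as the cut: avoidance itself makes it the only one.
\<close>

lemma avoider_is_block_swap:
  assumes "w \<in> avoiders {[2,1,3], [3,2,1]} n"
  shows "\<exists>c b a. c + b + a = n \<and> w = block_swap c b a"
proof (cases "sorted_wrt (<) w")
  case True
  then have "w = block_swap n 0 0"
    using assms strict_sorted_eq_upt unfolding block_swap_0
    by (auto simp: avoiders_def permutations_of_set_def simp del: upt_Suc)
  then show ?thesis by force
next
  case False
  have set_w: "set w = {1..n}" and dist: "distinct w"
    using assms by (auto simp: avoiders_def permutations_of_set_def)
  have no213: "\<not> (w ! j < w ! i \<and> w ! i < w ! k)"
    and no321: "\<not> (w ! k < w ! j \<and> w ! j < w ! i)"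
    if "i < j" "j < k" "k < length w" for i j k
  proof -
    have "\<not> contains_pattern w [2, 1, 3]" "\<not> contains_pattern w [3, 2, 1]"
      using assms by (simp_all add: avoiders_def)
    then show "\<not> (w ! j < w ! i \<and> w ! i < w ! k)" "\<not> (w ! k < w ! j \<and> w ! j < w ! i)"
      using that unfolding contains_213_iff[OF dist] contains_321_iff[OF dist] by blast+
  qed
  have neq: "w ! i \<noteq> w ! j" if "i < j" "j < length w" for i j
    using dist that by (simp add: nth_eq_iff_index_eq)
  have "\<not> sorted w" using False dist by (simp add: strict_sorted_iff)
  then obtain d where d: "Suc d < length w" "w ! Suc d < w ! d"
    by (auto simp: sorted_iff_nth_Suc not_le)
  have pre: "w ! i < w ! j" if "i < j" "j \<le> d" for i j
  proof (rule ccontr)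
    assume "\<not> w ! i < w ! j"
    then have ji: "w ! j < w ! i" using neq[of i j] that d by auto
    \<comment> \<open>Either \<open>w ! d\<close> completes a \<open>213\<close>, or it lies below \<open>w ! i\<close> and the descent completes a \<open>321\<close>.\<close>
    have "\<not> w ! d < w ! i" using no321[of i d "Suc d"] d that by auto
    then have "w ! i < w ! d" using neq[of i d] that d by auto
    then show False using no213[of i j d] ji that d by (cases "j = d") auto
  qed
  have below: "w ! k < w ! d" if "d < k" "k < length w" for k
    using no213[of d "Suc d" k] neq[of d k] d that by (cases "k = Suc d") auto
  have suf: "w ! k < w ! l" if "d < k" "k < l" "l < length w" for k l
    using no321[of d k l] below[of k] neq[of k l] that by auto
  define P where "P = take (Suc d) w"
  define C where "C = drop (Suc d) w"
  define m where "m = w ! Suc d"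
  define A where "A = filter (\<lambda>x. x < m) P"
  define B where "B = filter (\<lambda>x. \<not> x < m) P"
  have w: "w = P @ C" by (simp add: P_def C_def)
  have sP: "sorted_wrt (<) P"
    using pre d by (auto simp: P_def sorted_wrt_iff_nth_less)
  have sC: "sorted_wrt (<) C"
    using suf by (auto simp: C_def sorted_wrt_iff_nth_less)
  have P: "P = A @ B"
    using sorted_partition_less[of P m] sP by (simp add: A_def B_def strict_sorted_iff)
  have mC: "m \<le> x" if "x \<in> set C" for x
  proof -
    from that obtain k where k: "k < length w - Suc d" "x = w ! (Suc d + k)"
      by (auto simp: C_def in_set_conv_nth)
    then show ?thesis using suf[of "Suc d" "Suc d + k"] by (cases "k = 0") (auto simp: m_def intro: less_imp_le)
  qed
  have CB: "x < y" if x: "x \<in> set C" and y: "y \<in> set B" for x y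
  proof -
    from x obtain l where "l < length w - Suc d" "x = w ! (Suc d + l)"
      by (auto simp: C_def in_set_conv_nth)
    then obtain k where k: "Suc d \<le> k" "k < length w" "x = w ! k"
      using that[of "Suc d + l"] by auto
    from y obtain i where i: "i < Suc d" "y = w ! i" and "m \<le> y"
      by (auto simp: B_def P_def in_set_conv_nth)
    then have my: "m < y" using neq[of i "Suc d"] d by (auto simp: m_def)
    show ?thesis
    proof (cases "k = Suc d")
      case False
      then show ?thesis using no213[of i "Suc d" k] my i k neq[of i k] by (auto simp: m_def)
    qed (use my k in \<open>simp add: m_def\<close>)
  qed
  have AC: "x < y" if "x \<in> set A" "y \<in> set C" for x y
    using mC[OF that(2)] that(1) by (auto simp: A_def)
  have "sorted_wrt (<) (A @ C @ B)"
    using sP sC AC CB by (auto simp: P sorted_wrt_append)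
  moreover have "set (A @ C @ B) = {1..n}"
    using set_w by (auto simp: w P)
  ultimately have "A @ C @ B = [1..<Suc n]" by (rule strict_sorted_eq_upt)
  from append_eq_block_swap[OF this] show ?thesis by (auto simp: w P)
qed

theorem avoiders_eq:
  "avoiders {[2,1,3], [3,2,1]} n = {block_swap c b a | c b a. c + b + a = n}"
  using avoider_is_block_swap block_swap_in_avoiders by blast

section \<open>The statistics\<close>

lemma DES_identity: "DES [1..<Suc n] = {}"
  by (auto simp: DES_def entry_def simp del: upt_Suc)

lemma des_identity: "des [1..<Suc n] = 0"
  unfolding des_def DES_identity by simp

lemma iar_identity: "iar [1..<Suc n] = n"
  unfolding iar_def DES_identity by simp

lemma comp_identity: "comp [1..<Suc n] = n"
proof -
  have "{i \<in> {1..length [1..<Suc n]}. \<forall>j\<in>{1..i}. entry [1..<Suc n] j \<le> i} = {1..n}"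
    by (auto simp: entry_def simp del: upt_Suc)
  then show ?thesis by (simp add: comp_def)
qed

context
  fixes c b a :: nat
  assumes b: "0 < b" and a: "0 < a"
begin

lemma DES_block_swap: "DES (block_swap c b a) = {c + b}"
  using a b by (auto simp: DES_def entry_block_swap split: if_splits)

lemma des_block_swap: "des (block_swap c b a) = 1"
  unfolding des_def DES_block_swap by simp

lemma iar_block_swap: "iar (block_swap c b a) = c + b"
  unfolding iar_def DES_block_swap by simp

lemma comp_block_swap: "comp (block_swap c b a) = Suc c"
proof -
  let ?w = "block_swap c b a" and ?n = "c + b + a"
  have "{i \<in> {1..length ?w}. \<forall>j\<in>{1..i}. entry ?w j \<le> i} = insert ?n {1..c}" (is "?L = ?R")
  proof (intro equalityI subsetI)
    fix i assume "i \<in> ?L"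
    then have i: "1 \<le> i" "i \<le> ?n" and le: "\<And>j. 1 \<le> j \<Longrightarrow> j \<le> i \<Longrightarrow> entry ?w j \<le> i"
      by auto
    show "i \<in> ?R"
    proof (rule ccontr)
      assume "i \<notin> ?R"
      then have ci: "c < i" "i < ?n" using i by auto
      \<comment> \<open>Within the raised block the letter at \<open>i\<close> exceeds \<open>i\<close>; beyond it, the maximum \<open>?n\<close>, at
        position \<open>c + b\<close>, does.\<close>
      show False
      proof (cases "i \<le> c + b")
        case True
        then show False using le[of i] ci a by (simp add: entry_block_swap)
      next
        case False
        then show False using le[of "c + b"] ci b by (simp add: entry_block_swap)
      qed
    qed
  next
    fix i assume "i \<in> ?R"
    then show "i \<in> ?L" using b by (auto simp: entry_block_swap)
  qed
  then show ?thesis using b by (simp add: comp_def)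
qed

end

section \<open>The generating function\<close>

text \<open>
  Every triple with an empty second or third block describes the identity; all other triples
  describe distinct words. Separating the identity makes the parametrisation injective.
\<close>

lemma avoiders_eq_insert_identity:
  "avoiders {[2,1,3], [3,2,1]} n = insert [1..<Suc n]
    {block_swap c b a | c b a. c + b + a = n \<and> 0 < b \<and> 0 < a}"
proof -
  have id: "block_swap c b a = [1..<Suc (c + b + a)]" if "b = 0 \<or> a = 0" for c b a
    by (rule nth_equalityI) (use that in \<open>auto simp: nth_block_swap simp del: upt_Suc\<close>)
  show ?thesis
    unfolding avoiders_eq
  proof (intro equalityI subsetI)
    fix w assume "w \<in> {block_swap c b a | c b a. c + b + a = n}"
    then obtain c b a where w: "w = block_swap c b a" "c + b + a = n" by blast
    show "w \<in> insert [1..<Suc n] {block_swap c b a | c b a. c + b + a = n \<and> 0 < b \<and> 0 < a}"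
    proof (cases "b = 0 \<or> a = 0")
      case True
      then show ?thesis using id[OF True, of c] w by (simp del: upt_Suc)
    next
      case False
      then show ?thesis using w by auto
    qed
  next
    fix w
    assume "w \<in> insert [1..<Suc n] {block_swap c b a | c b a. c + b + a = n \<and> 0 < b \<and> 0 < a}"
    then consider "w = block_swap n 0 0"
      | c b a where "w = block_swap c b a" "c + b + a = n"
      unfolding block_swap_0 by blast
    then show "w \<in> {block_swap c b a | c b a. c + b + a = n}"
    proof cases
      case 1
      moreover have "n + 0 + 0 = n" by simp
      ultimately show ?thesis by blast
    next
      case 2
      then show ?thesis by blast
    qed
  qed
qed

lemma sum_avoiders_0:
  fixes t r p :: "'a::comm_semiring_1"
  shows "(\<Sum>w\<in>avoiders {[2,1,3], [3,2,1]} 0. t ^ des w * r ^ iar w * p ^ comp w) = 1"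
proof -
  have "avoiders {[2,1,3], [3,2,1]} 0 = {[1..<Suc 0]}"
    unfolding avoiders_eq_insert_identity by auto
  then show ?thesis
    using des_identity[of 0] iar_identity[of 0] comp_identity[of 0] by simp
qed

text \<open>
  The sum runs over the pairs \<open>(a - 1, b - 1)\<close> and is nested in the same way as the coefficients
  of a product of three power series.
\<close>

lemma sum_avoiders_Suc:
  fixes t r p :: "'a::comm_semiring_1"
  shows "(\<Sum>w\<in>avoiders {[2,1,3], [3,2,1]} (Suc n). t ^ des w * r ^ iar w * p ^ comp w) =
    r * p * ((r * p) ^ n +
      (if n = 0 then 0 else t * (\<Sum>i=0..n-1. \<Sum>j=0..n-1-i. r ^ j * (r * p) ^ (n - 1 - i - j))))"
proof (cases n)
  case 0
  have "avoiders {[2,1,3], [3,2,1]} (Suc 0) = {[1..<Suc 1]}"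
    unfolding avoiders_eq_insert_identity by auto
  then show ?thesis
    unfolding 0 using des_identity[of 1] iar_identity[of 1] comp_identity[of 1] by simp
next
  case (Suc m)
  let ?wt = "\<lambda>w. t ^ des w * r ^ iar w * p ^ comp w"
  let ?I = "SIGMA i:{0..m}. {0..m - i}"
  define f where "f = (\<lambda>(i, j). block_swap (m - i - j) (Suc j) (Suc i))"
  have stats: "des (f (i, j)) = 1" "iar (f (i, j)) = m - i - j + Suc j"
    "comp (f (i, j)) = Suc (m - i - j)" for i j
    by (simp_all add: f_def des_block_swap iar_block_swap comp_block_swap)
  have "inj_on f ?I"
  proof (rule inj_onI, safe)
    fix i j i' j'
    assume *: "i \<in> {0..m}" "j \<in> {0..m - i}" "i' \<in> {0..m}" "j' \<in> {0..m - i'}"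
      and eq: "f (i, j) = f (i', j')"
    have "m - i - j = m - i' - j'" "m - i - j + Suc j = m - i' - j' + Suc j'"
      using arg_cong[OF eq, of comp] arg_cong[OF eq, of iar] by (simp_all add: stats)
    then show "i = i'" "j = j'" using * by auto
  qed
  moreover have "{block_swap c b a | c b a. c + b + a = Suc n \<and> 0 < b \<and> 0 < a} = f ` ?I"
  proof (intro equalityI subsetI)
    fix w assume "w \<in> {block_swap c b a | c b a. c + b + a = Suc n \<and> 0 < b \<and> 0 < a}"
    then obtain c b a where "w = block_swap c b a" "c + b + a = Suc n" "0 < b" "0 < a"
      by blast
    then have "w = f (a - 1, b - 1)" "(a - 1, b - 1) \<in> ?I"
      by (auto simp: f_def Suc intro!: arg_cong3[where f = block_swap])
    then show "w \<in> f ` ?I" by blast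
  next
    fix w assume "w \<in> f ` ?I"
    then obtain i j where "i \<le> m" "j \<le> m - i" "w = block_swap (m - i - j) (Suc j) (Suc i)"
      by (auto simp: f_def)
    moreover from this have "m - i - j + Suc j + Suc i = Suc n" by (simp add: Suc)
    ultimately show "w \<in> {block_swap c b a | c b a. c + b + a = Suc n \<and> 0 < b \<and> 0 < a}"
      by blast
  qed
  moreover have "[1..<Suc (Suc n)] \<notin> f ` ?I"
  proof
    assume "[1..<Suc (Suc n)] \<in> f ` ?I"
    then obtain i j where "[1..<Suc (Suc n)] = f (i, j)" by auto
    from arg_cong[OF this, of des] show False by (simp only: des_identity stats)
  qed
  ultimately have "sum ?wt (avoiders {[2,1,3], [3,2,1]} (Suc n)) =
      ?wt [1..<Suc (Suc n)] + (\<Sum>x\<in>?I. ?wt (f x))"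
    unfolding avoiders_eq_insert_identity
    by (simp add: sum.reindex del: upt_Suc)
  also have "?wt [1..<Suc (Suc n)] = r * p * (r * p) ^ n"
    unfolding des_identity iar_identity comp_identity by (simp add: power_mult_distrib ac_simps)
  also have "(\<Sum>x\<in>?I. ?wt (f x)) =
      (\<Sum>(i, j)\<in>?I. r * p * (t * (r ^ j * (r * p) ^ (m - i - j))))"
    by (intro sum.cong refl, clarify)
      (simp only: prod.case stats power_add power_Suc power_one_right power_mult_distrib mult_ac)
  also have "\<dots> = r * p * (t * (\<Sum>i=0..m. \<Sum>j=0..m-i. r ^ j * (r * p) ^ (m - i - j)))"
    by (simp add: sum.Sigma[symmetric] sum_distrib_left)
  finally show ?thesis by (simp add: Suc distrib_left)
qed

lemma inverse_one_minus_const_X: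
  "inverse (1 - fps_const x * fps_X) = Abs_fps (\<lambda>n. x ^ n)" for x :: "'a::field"
proof (rule fps_inverse_unique)
  show "(1 - fps_const x * fps_X) * Abs_fps (\<lambda>n. x ^ n) = 1"
  proof (rule fps_ext)
    fix n show "fps_nth ((1 - fps_const x * fps_X) * Abs_fps (\<lambda>n. x ^ n)) n = fps_nth 1 n"
      by (cases n) (simp_all add: algebra_simps)
  qed
qed

theorem theorem4p9:
  fixes t r p :: "'a::field"
  assumes "r \<noteq> 0" and "p \<noteq> 0"
  shows "S_tilde {[2,1,3], [3,2,1]} t r p =
    1 / (1 - fps_const r * fps_const p * fps_X) +
    (fps_const t * fps_X) /
      ((1 - fps_X) * (1 - fps_const r * fps_X) * (1 - fps_const r * fps_const p * fps_X))"
proof -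
  let ?G = "\<lambda>x::'a. Abs_fps (\<lambda>n. x ^ n)"
  define H where "H = ?G 1 * (?G r * ?G (r * p))"
  have triple: "fps_nth H m = (\<Sum>i=0..m. \<Sum>j=0..m-i. r ^ j * (r * p) ^ (m - i - j))" for m
    by (simp add: H_def fps_mult_nth)
  have inv1: "inverse (1 - fps_X :: 'a fps) = ?G 1"
    using inverse_one_minus_const_X[of "1::'a"] by simp
  have invrp: "inverse (1 - fps_const r * fps_const p * fps_X) = ?G (r * p)"
    using inverse_one_minus_const_X[of "r * p"] by simp
  have "1 / (1 - fps_const r * fps_const p * fps_X) =
      1 * inverse (1 - fps_const r * fps_const p * fps_X)"
    by (rule fps_divide_unit) simp
  then have div_rp: "1 / (1 - fps_const r * fps_const p * fps_X) = ?G (r * p)"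
    by (simp only: invrp mult_1_left)
  have prod0: "fps_nth ((1 - fps_X) * (1 - fps_const r * fps_X) *
      (1 - fps_const r * fps_const p * fps_X)) 0 \<noteq> (0::'a)"
    by simp
  have rhs: "1 / (1 - fps_const r * fps_const p * fps_X) + (fps_const t * fps_X) /
      ((1 - fps_X) * (1 - fps_const r * fps_X) * (1 - fps_const r * fps_const p * fps_X))
    = ?G (r * p) + fps_X * (fps_const t * H)" (is "?rhs = ?F")
    unfolding div_rp fps_divide_unit[OF prod0] fps_inverse_mult inv1 invrp
      inverse_one_minus_const_X H_def
    by (simp only: mult_ac)
  have "S_gf {[2,1,3], [3,2,1]} t r p - 1 = fps_const r * fps_const p * fps_X * ?F"
  proof (rule fps_ext)
    fix n
    show "fps_nth (S_gf {[2,1,3], [3,2,1]} t r p - 1) n =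
      fps_nth (fps_const r * fps_const p * fps_X * ?F) n"
    proof (cases n)
      case 0
      have "fps_nth (S_gf {[2,1,3], [3,2,1]} t r p) 0 = 1"
        by (simp only: S_gf_def fps_nth_Abs_fps sum_avoiders_0)
      with 0 show ?thesis by (simp add: mult.assoc)
    next
      case (Suc k)
      have "fps_nth (fps_const r * fps_const p * fps_X * ?F) (Suc k) = r * p * fps_nth ?F k"
        by (simp add: mult.assoc)
      also have "fps_nth ?F k = (r * p) ^ k + (if k = 0 then 0 else
          t * (\<Sum>i=0..k-1. \<Sum>j=0..k-1-i. r ^ j * (r * p) ^ (k - 1 - i - j)))"
        by (cases k) (simp_all add: triple)
      also have "r * p * \<dots> = fps_nth (S_gf {[2,1,3], [3,2,1]} t r p) (Suc k)"
        by (simp only: S_gf_def fps_nth_Abs_fps sum_avoiders_Suc)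
      finally show ?thesis by (simp add: Suc)
    qed
  qed
  then show ?thesis
    unfolding S_tilde_def rhs using assms by simp
qed

end
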